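(* For every integer $n\geq 7$ with $n\equiv 1$ or $5\pmod 6$, there exists a regular SAMS$(n,4)$.
   Context: For positive integers $n,d$ with $d<n$, an $n\times n$ array $A$ with entries in $\{0,1,\dots,nd\}$ is a sparse anti-magic square of order $n$ with density $d$, denoted SAMS$(n,d)$, if each element of $\{1,2,\dots,nd\}$ occurs in exactly one entry of $A$ (all other entries being $0$), and the $n$ row-sums, $n$ column-sums and the two main diagonal sums (left diagonal: entries $(i,i)$; right diagonal: entries $(i,n+1-i)$) together form a set of $2n+2$ consecutive integers. An SAMS$(n,d)$ is regular if each row, each column and each of the two main diagonals contains exactly $d$ positive entries. *)

theory Defs
  imports Main
begin

text \<open>An \<open>n \<times> n\<close> array is a function \<open>A\<close> with entries \<open>A i j\<close> for \<open>i, j \<in> {1..n}\<close>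
  (row \<open>i\<close>, column \<open>j\<close>); its values elsewhere are never consulted.\<close>

definition row_sum :: "nat \<Rightarrow> (nat \<Rightarrow> nat \<Rightarrow> nat) \<Rightarrow> nat \<Rightarrow> nat" where
  "row_sum n A i = (\<Sum>j = 1..n. A i j)"

definition col_sum :: "nat \<Rightarrow> (nat \<Rightarrow> nat \<Rightarrow> nat) \<Rightarrow> nat \<Rightarrow> nat" where
  "col_sum n A j = (\<Sum>i = 1..n. A i j)"

definition left_diag_sum :: "nat \<Rightarrow> (nat \<Rightarrow> nat \<Rightarrow> nat) \<Rightarrow> nat" where
  "left_diag_sum n A = (\<Sum>i = 1..n. A i i)"

definition right_diag_sum :: "nat \<Rightarrow> (nat \<Rightarrow> nat \<Rightarrow> nat) \<Rightarrow> nat" where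
  "right_diag_sum n A = (\<Sum>i = 1..n. A i (n + 1 - i))"

definition line_sums :: "nat \<Rightarrow> (nat \<Rightarrow> nat \<Rightarrow> nat) \<Rightarrow> nat set" where
  "line_sums n A = row_sum n A ` {1..n} \<union> col_sum n A ` {1..n}
     \<union> {left_diag_sum n A, right_diag_sum n A}"

text \<open>In the last conjunct the interval has \<open>2 * n + 2\<close> elements, as many as there are rows,
  columns and diagonals, so the set equation forces all these sums to be distinct.\<close>

definition SAMS :: "nat \<Rightarrow> nat \<Rightarrow> (nat \<Rightarrow> nat \<Rightarrow> nat) \<Rightarrow> bool" where
  "SAMS n d A \<longleftrightarrow>
     0 < d \<and> d < n \<and>
     (\<forall>i\<in>{1..n}. \<forall>j\<in>{1..n}. A i j \<in> {0..n * d}) \<and>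
     (\<forall>k\<in>{1..n * d}. \<exists>!p. p \<in> {1..n} \<times> {1..n} \<and> A (fst p) (snd p) = k) \<and>
     (\<exists>a. line_sums n A = {a..<a + (2 * n + 2)})"

definition regular_SAMS :: "nat \<Rightarrow> nat \<Rightarrow> (nat \<Rightarrow> nat \<Rightarrow> nat) \<Rightarrow> bool" where
  "regular_SAMS n d A \<longleftrightarrow>
     SAMS n d A \<and>
     (\<forall>i\<in>{1..n}. card {j\<in>{1..n}. A i j > 0} = d) \<and>
     (\<forall>j\<in>{1..n}. card {i\<in>{1..n}. A i j > 0} = d) \<and>
     card {i\<in>{1..n}. A i i > 0} = d \<and>
     card {i\<in>{1..n}. A i (n + 1 - i) > 0} = d"

end

theory Submission
  imports Defs "HOL-Computational_Algebra.Primes"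
begin

text \<open>Since \<open>n\<close> is coprime to 6, the cells \<open>(i, 2 i + c)\<close> modulo \<open>n\<close>, for a fixed \<open>c\<close>, form a
  transversal that also meets each main diagonal exactly once. Four such transversals carry the
  positive entries, the first holding the numbers \<open>1, \<dots>, n\<close>, the second \<open>n + 1, \<dots>, 2 n\<close>, and so on.
  Write \<open>n = 2 h + 1\<close> and let \<open>x \<in> {0..<n}\<close> be a shifted row coordinate. The residues placed on the
  transversals \<open>c = 0, 5, 2, 1\<close> are \<open>x\<close>, \<open>x + h + 2\<close>, \<open>x\<close> and \<open>h - 1 - x\<close>. Three increasing lines against
  one decreasing line make both the row sums and the column sums progressions of step 2, of
  opposite parity: the columns give \<open>7 n + 3, 7 n + 5, \<dots>, 9 n + 1\<close>, and the rows give
  \<open>7 n + 4, 7 n + 6, \<dots>, 9 n + 2\<close> except that row \<open>x = h - 1\<close> gives \<open>7 n + 1\<close> in place of \<open>8 n + 1\<close>.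
  The shift of the row coordinate is chosen so that the diagonals give the two missing values
  \<open>7 n + 2\<close> and \<open>8 n + 1\<close>.\<close>

section \<open>Residues modulo \<open>n\<close>\<close>

lemma eq_if_dvd_mult_diff:
  fixes a x y m :: int
  assumes "m dvd a * (x - y)" "coprime a m" "x \<in> {0..<m}" "y \<in> {0..<m}"
  shows "x = y"
proof -
  have "m dvd x - y"
    using assms(1,2) by (simp add: coprime_commute coprime_dvd_mult_right_iff)
  then have "x mod m = y mod m" by (simp add: mod_eq_dvd_iff)
  then show ?thesis using assms(3,4) by simp
qed

text \<open>Along rows, columns, left and right diagonal the transversal index is affine with slope
  1, -2, -1 and -3; this is where coprimality to 6 enters.\<close>

lemma inj_on_affine_mod:
  fixes a b :: int
  assumes "coprime a (int n)"
  shows "inj_on (\<lambda>t::nat. (a * int t + b) mod int n) {1..n}"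
proof (rule inj_onI)
  fix s t assume s: "s \<in> {1..n}" and t: "t \<in> {1..n}"
    and eq: "(a * int s + b) mod int n = (a * int t + b) mod int n"
  have "int n dvd a * ((int s - 1) - (int t - 1))"
    using eq by (simp add: mod_eq_dvd_iff algebra_simps)
  then have "int s - 1 = int t - 1"
    by (rule eq_if_dvd_mult_diff[OF _ assms]) (use s t in auto)
  then show "s = t" by simp
qed

section \<open>The array in residue coordinates\<close>

locale order_coprime_to_6 =
  fixes n :: nat and h :: int
  assumes n_eq: "int n = 2 * h + 1" and h_ge: "h \<ge> 3" and not_3_dvd: "\<not> 3 dvd n"
begin

text \<open>Up to a multiple of \<open>n\<close>, this is \<open>5 / 4\<close>.\<close>

definition shift :: int where
  "shift = (h + 3) * (h + 1)"

text \<open>\<open>xc i\<close> is the coordinate \<open>x\<close> of row \<open>i\<close>, and \<open>wc i j\<close> tells on which transversal \<open>c\<close> the cell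
  lies.\<close>

definition xc :: "nat \<Rightarrow> int" where
  "xc i = (int i - 1 - shift) mod int n"

definition wc :: "nat \<Rightarrow> nat \<Rightarrow> int" where
  "wc i j = (int j + 3 - 2 * int i + shift) mod int n"

text \<open>Reductions modulo \<open>n\<close> are written as case distinctions, which keeps every
  wrap-around within linear arithmetic.\<close>

definition entry :: "int \<Rightarrow> int \<Rightarrow> nat" where
  "entry x w = nat (
     if w = 0 then 1 + x
     else if w = 5 then int n + 1 + (if x \<le> h - 2 then x + h + 2 else x + h + 2 - int n)
     else if w = 2 then 2 * int n + 1 + x
     else if w = 1 then 3 * int n + 1 + (if x \<le> h - 1 then h - 1 - x else h - 1 - x + int n)
     else 0)"

definition sq :: "nat \<Rightarrow> nat \<Rightarrow> nat" where
  "sq i j = entry (xc i) (wc i j)"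

lemma n_pos: "0 < n"
  using n_eq h_ge by linarith

lemma xc_range: "xc i \<in> {0..<int n}"
  and wc_range: "wc i j \<in> {0..<int n}"
  by (simp_all add: xc_def wc_def n_pos)

lemma dvd_xc: "int n dvd xc i - (int i - 1 - shift)"
  and dvd_wc: "int n dvd wc i j - (int j + 3 - 2 * int i + shift)"
  by (simp_all add: xc_def wc_def mod_eq_dvd_iff flip: mod_eq_dvd_iff)

lemma dvd_shift: "int n dvd 2 * shift - (h + 3)"
proof -
  have "2 * shift - (h + 3) = int n * (h + 3)"
    by (simp add: shift_def n_eq algebra_simps)
  then show ?thesis by simp
qed

lemma coprime_2: "coprime 2 (int n)"
  by (simp add: n_eq)

lemma coprime_3: "coprime 3 (int n)"
proof -
  have "coprime 3 n" using not_3_dvd by (intro prime_imp_coprime) auto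
  then show ?thesis by (metis coprime_int_iff of_nat_numeral)
qed

lemma coprime_h1: "coprime (h + 1) (int n)"
proof (rule coprimeI)
  fix c assume "c dvd h + 1" "c dvd int n"
  then have "c dvd 2 * (h + 1) - int n" by (intro dvd_diff dvd_mult)
  then show "is_unit c" by (simp add: n_eq)
qed

lemma entry_pos_iff:
  assumes "x \<in> {0..<int n}"
  shows "entry x w > 0 \<longleftrightarrow> w \<in> {0, 1, 2, 5}"
  using assms n_eq h_ge by (auto simp: entry_def)

text \<open>An injective \<open>w\<close> takes every residue once, so the line meets each
  transversal in one cell, with row coordinate \<open>X c\<close>; its other cells hold 0.\<close>

lemma line:
  assumes inj: "inj_on w {1..n}" and w: "\<And>t. w t \<in> {0..<int n}" and x: "\<And>t. x t \<in> {0..<int n}"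
    and X: "\<And>t c. \<lbrakk>t \<in> {1..n}; c \<in> {0, 1, 2, 5}; w t = c\<rbrakk> \<Longrightarrow> x t = X c"
  shows "(\<Sum>t = 1..n. entry (x t) (w t)) = entry (X 0) 0 + entry (X 5) 5 + entry (X 2) 2 + entry (X 1) 1"
    and "card {t \<in> {1..n}. entry (x t) (w t) > 0} = 4"
proof -
  define T where "T = {t \<in> {1..n}. w t \<in> {0, 1, 2, 5}}"
  have im: "w ` {1..n} = {0..<int n}"
    by (rule card_subset_eq) (use inj w in \<open>auto simp: card_image\<close>)
  have "{0, 1, 2, 5} \<subseteq> {0..<int n}" using n_eq h_ge by auto
  moreover have "w ` T = w ` {1..n} \<inter> {0, 1, 2, 5}" by (auto simp: T_def)
  ultimately have imT: "w ` T = {0, 1, 2, 5}" unfolding im by blast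
  have injT: "inj_on w T" using inj by (rule inj_on_subset) (auto simp: T_def)
  have "(\<Sum>t = 1..n. entry (x t) (w t)) = (\<Sum>t\<in>T. entry (x t) (w t))"
    by (rule sum.mono_neutral_right) (use entry_pos_iff[OF x] in \<open>auto simp: T_def\<close>)
  also have "\<dots> = (\<Sum>t\<in>T. entry (X (w t)) (w t))"
  proof (rule sum.cong[OF refl])
    fix t assume "t \<in> T"
    then have "x t = X (w t)" by (intro X) (auto simp: T_def)
    then show "entry (x t) (w t) = entry (X (w t)) (w t)" by simp
  qed
  also have "\<dots> = (\<Sum>c\<in>{0, 1, 2, 5}. entry (X c) c)"
    using sum.reindex[OF injT, of "\<lambda>c. entry (X c) c"] imT by simp
  finally show "(\<Sum>t = 1..n. entry (x t) (w t)) = entry (X 0) 0 + entry (X 5) 5 + entry (X 2) 2 + entry (X 1) 1"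
    by simp
  have "{t \<in> {1..n}. entry (x t) (w t) > 0} = T"
    using entry_pos_iff[OF x] by (auto simp: T_def)
  then show "card {t \<in> {1..n}. entry (x t) (w t) > 0} = 4"
    using card_image[OF injT] imT by simp
qed

section \<open>Sums along rows, columns and diagonals\<close>

lemma inj_wc_row: "inj_on (wc i) {1..n}"
  using inj_on_affine_mod[of 1 n "3 - 2 * int i + shift"]
  by (simp add: wc_def[abs_def] algebra_simps)

lemma inj_wc_col: "inj_on (\<lambda>i. wc i j) {1..n}"
  using inj_on_affine_mod[of "-2" n "int j + 3 + shift"] coprime_2
  by (simp add: wc_def[abs_def] algebra_simps)

lemma inj_wc_left: "inj_on (\<lambda>i. wc i i) {1..n}"
  using inj_on_affine_mod[of "-1" n "3 + shift"]
  by (simp add: wc_def[abs_def] algebra_simps)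

lemma wc_right: "i \<in> {1..n} \<Longrightarrow> wc i (n + 1 - i) = (-3 * int i + (int n + 4 + shift)) mod int n"
  by (auto simp: wc_def of_nat_diff algebra_simps)

lemma inj_wc_right: "inj_on (\<lambda>i. wc i (n + 1 - i)) {1..n}"
  by (rule inj_on_cong[OF wc_right, THEN iffD2], assumption, rule inj_on_affine_mod)
    (simp add: coprime_3)

text \<open>The unreduced residues add up to \<open>2 * x + n\<close>. The wraps on
  \<open>c = 5\<close> and \<open>c = 1\<close> cancel, except that at \<open>x = h - 1\<close> only
  \<open>c = 5\<close> wraps, which costs \<open>n\<close>.\<close>

lemma row:
  shows "row_sum n sq i = nat (if xc i = h - 1 then 7 * int n + 1 else 7 * int n + 4 + 2 * xc i)"
    and "card {j \<in> {1..n}. sq i j > 0} = 4"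
proof -
  note L = line[OF inj_wc_row wc_range xc_range, of i "\<lambda>_. i" "\<lambda>_. xc i", simplified, folded sq_def]
  show "card {j \<in> {1..n}. sq i j > 0} = 4" using L(2) by simp
  have "row_sum n sq i = entry (xc i) 0 + entry (xc i) 5 + entry (xc i) 2 + entry (xc i) 1"
    using L(1) by (simp add: row_sum_def)
  then show "row_sum n sq i = nat (if xc i = h - 1 then 7 * int n + 1 else 7 * int n + 4 + 2 * xc i)"
    using xc_range[of i] n_eq h_ge by (auto simp: entry_def)
qed

text \<open>\<open>h + 1\<close> is the inverse of 2 modulo \<open>n\<close>, so \<open>uc j\<close> is the coordinate of the row in which column \<open>j\<close>
  meets the transversal \<open>c = 2\<close>.\<close>

definition uc :: "nat \<Rightarrow> int" where
  "uc j = ((h + 1) * int j - (h + 1) * (1 + shift)) mod int n"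

lemma uc_range: "uc j \<in> {0..<int n}"
  by (simp add: uc_def n_pos)

lemma dvd_uc: "int n dvd 2 * uc j - (int j - 1 - shift)"
proof -
  let ?v = "(h + 1) * int j - (h + 1) * (1 + shift)"
  have "int n dvd uc j - ?v"
    by (simp add: uc_def mod_eq_dvd_iff flip: mod_eq_dvd_iff)
  then have "int n dvd 2 * (uc j - ?v)" by (rule dvd_mult)
  \<comment> \<open>The added multiple of \<open>n\<close> absorbs the excess in
    \<open>2 * (h + 1) = int n + 1\<close>.\<close>
  then have "int n dvd 2 * (uc j - ?v) + int n * (int j - 1 - shift)" by simp
  also have "2 * (uc j - ?v) + int n * (int j - 1 - shift) = 2 * uc j - (int j - 1 - shift)"
    by (simp add: n_eq algebra_simps)
  finally show ?thesis .
qed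

text \<open>With \<open>u = uc j\<close>, the residues for \<open>c = 0, 5, 2, 1\<close> are
  \<open>u + 1\<close>, \<open>u\<close>, \<open>u\<close> and \<open>-2 - u\<close> modulo
  \<open>n\<close>; at \<open>u = 2 * h\<close> the extra wraps of the first and last
  cancel.\<close>

lemma col:
  shows "col_sum n sq j = nat (7 * int n + 3 + 2 * uc j)"
    and "card {i \<in> {1..n}. sq i j > 0} = 4"
proof -
  define u where "u = uc j"
  \<comment> \<open>This is \<open>u + 1 - c / 2\<close> modulo \<open>n\<close>, with
    \<open>h + 1\<close> as the inverse of 2.\<close>
  define X where "X c = (if c = 0 then if u < 2 * h then u + 1 else 0
    else if c = 5 then if u \<le> h + 1 then u + h - 1 else u - h - 2
    else if c = 2 then u
    else if u < h then u + 1 + h else u - h)" for c :: int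
  have u: "u \<in> {0..<int n}" "int n dvd 2 * u - (int j - 1 - shift)"
    using uc_range dvd_uc by (auto simp: u_def)
  have X: "xc i = X c" if c: "c \<in> {0, 1, 2, 5}" "wc i j = c" for i c
  proof (rule eq_if_dvd_mult_diff[OF _ coprime_2 xc_range])
    show "X c \<in> {0..<int n}" using u(1) n_eq h_ge by (auto simp: X_def)
    have "int n dvd 2 * (xc i - (int i - 1 - shift)) + (wc i j - (int j + 3 - 2 * int i + shift))
         - (2 * u - (int j - 1 - shift))"
      by (rule dvd_diff[OF dvd_add[OF dvd_mult[OF dvd_xc] dvd_wc] u(2)])
    then have 1: "int n dvd 2 * xc i - 2 * u - 2 + c" using c(2) by (simp add: algebra_simps)
    obtain k where "2 * X c = 2 * u + 2 - c + int n * k"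
    proof -
      \<comment> \<open>The value -2 occurs only for \<open>c = 0\<close>,
        \<open>u = 2 * h\<close>.\<close>
      have "\<exists>k\<in>{-1, 0, 1, -2}. 2 * X c = 2 * u + 2 - c + int n * k"
        using c(1) n_eq u(1) by (auto simp: X_def)
      then show ?thesis using that by blast
    qed
    then have "2 * (xc i - X c) = (2 * xc i - 2 * u - 2 + c) - int n * k" by simp
    then show "int n dvd 2 * (xc i - X c)" using dvd_diff[OF 1 dvd_triv_left] by metis
  qed
  note L = line[of "\<lambda>i. wc i j" xc X, OF inj_wc_col wc_range xc_range X, folded sq_def]
  show "card {i \<in> {1..n}. sq i j > 0} = 4" using L(2) by simp
  have "col_sum n sq j = entry (X 0) 0 + entry (X 5) 5 + entry (X 2) 2 + entry (X 1) 1"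
    using L(1) by (simp add: col_sum_def)
  then show "col_sum n sq j = nat (7 * int n + 3 + 2 * uc j)"
    using u(1) n_eq h_ge by (auto simp: entry_def X_def simp flip: u_def)
qed

lemma left_diag:
  shows "left_diag_sum n sq = nat (7 * int n + 2)"
    and "card {i \<in> {1..n}. sq i i > 0} = 4"
proof -
  \<comment> \<open>Here \<open>xc i + wc i i\<close> is 2 modulo \<open>n\<close>, and only
    \<open>c = 5\<close> makes \<open>2 - c\<close> negative.\<close>
  define X where "X c = (if c = 5 then int n - 3 else 2 - c)" for c :: int
  have X: "xc i = X c" if c: "c \<in> {0, 1, 2, 5}" "wc i i = c" for i c
  proof (rule eq_if_dvd_mult_diff[of "int n" 1, OF _ _ xc_range])
    show "X c \<in> {0..<int n}" using c(1) n_eq h_ge by (auto simp: X_def)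
    have "int n dvd (xc i - (int i - 1 - shift)) + (wc i i - (int i + 3 - 2 * int i + shift))"
      by (rule dvd_add[OF dvd_xc dvd_wc])
    then have 1: "int n dvd xc i - (2 - c)" using c(2) by (simp add: algebra_simps)
    then have "int n dvd xc i - (2 - c) - int n" by simp
    with 1 show "int n dvd 1 * (xc i - X c)" using c(1) by (auto simp: X_def algebra_simps)
  qed simp
  note L = line[of "\<lambda>i. wc i i" xc X, OF inj_wc_left wc_range xc_range X, folded sq_def]
  show "card {i \<in> {1..n}. sq i i > 0} = 4" using L(2) by simp
  have "left_diag_sum n sq = entry (X 0) 0 + entry (X 5) 5 + entry (X 2) 2 + entry (X 1) 1"
    using L(1) by (simp add: left_diag_sum_def)
  then show "left_diag_sum n sq = nat (7 * int n + 2)"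
    using n_eq h_ge by (auto simp: entry_def X_def)
qed

text \<open>The cell on transversal \<open>c\<close> satisfies \<open>3 * x = - (h + 2 + c)\<close>
  modulo \<open>n\<close>. Its explicit solution depends on \<open>h\<close> modulo 3, where
  remainder 1 would make 3 divide \<open>n\<close>.\<close>

lemma right_diag:
  shows "right_diag_sum n sq = nat (8 * int n + 1)"
    and "card {i \<in> {1..n}. sq i (n + 1 - i) > 0} = 4"
proof -
  have "h mod 3 \<noteq> 1"
  proof
    assume "h mod 3 = 1"
    then have "3 dvd int n" using n_eq by presburger
    then show False using not_3_dvd by presburger
  qed
  then have "h = 3 * (h div 3) \<or> h = 3 * (h div 3) + 2" by presburger
  then consider q where "h = 3 * q" | q where "h = 3 * q + 2" by blast
  then obtain X where X_range: "\<And>c. c \<in> {0, 1, 2, 5} \<Longrightarrow> X c \<in> {0..<int n}"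
    and X_eq: "\<And>c. c \<in> {0, 1, 2, 5} \<Longrightarrow> \<exists>k. 3 * X c = int n * k - h - 2 - c"
    and X_sum: "entry (X 0) 0 + entry (X 5) 5 + entry (X 2) 2 + entry (X 1) 1 = nat (8 * int n + 1)"
  proof cases
    case (1 q)
    \<comment> \<open>For \<open>q = 1\<close>, that is \<open>n = 7\<close>, the residue
      \<open>q - 2 = -1\<close> wraps to 6.\<close>
    define X where "X c = (if c = 0 then 3 * q else if c = 5 then if q = 1 then 6 else q - 2
      else if c = 2 then q - 1 else 5 * q)" for c :: int
    show ?thesis
    proof (rule that[of X])
      fix c :: int assume c: "c \<in> {0, 1, 2, 5}"
      then show "X c \<in> {0..<int n}" using 1 n_eq h_ge by (auto simp: X_def)
      have "\<exists>k\<in>{1, 2, 3, 4}. 3 * X c = int n * k - h - 2 - c"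
        using c 1 n_eq by (auto simp: X_def)
      then show "\<exists>k. 3 * X c = int n * k - h - 2 - c" by blast
    qed (use 1 n_eq h_ge in \<open>unfold X_def entry_def, auto\<close>)
  next
    case (2 q)
    define X where "X c = (if c = 0 then 3 * q + 2 else if c = 5 then 5 * q + 2
      else if c = 2 then 5 * q + 3 else q)" for c :: int
    show ?thesis
    proof (rule that[of X])
      fix c :: int assume c: "c \<in> {0, 1, 2, 5}"
      then show "X c \<in> {0..<int n}" using 2 n_eq h_ge by (auto simp: X_def)
      have "\<exists>k\<in>{1, 2, 3, 4}. 3 * X c = int n * k - h - 2 - c"
        using c 2 n_eq by (auto simp: X_def)
      then show "\<exists>k. 3 * X c = int n * k - h - 2 - c" by blast
    qed (use 2 n_eq h_ge in \<open>unfold X_def entry_def, auto\<close>)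
  qed
  have X: "xc i = X c" if i: "i \<in> {1..n}" and c: "c \<in> {0, 1, 2, 5}" "wc i (n + 1 - i) = c" for i c
  proof (rule eq_if_dvd_mult_diff[OF _ coprime_3 xc_range X_range[OF c(1)]])
    have "int n dvd 3 * (xc i - (int i - 1 - shift))
        + (wc i (n + 1 - i) - (int (n + 1 - i) + 3 - 2 * int i + shift)) - (2 * shift - (h + 3))"
      by (rule dvd_diff[OF dvd_add[OF dvd_mult[OF dvd_xc] dvd_wc] dvd_shift])
    then have 1: "int n dvd 3 * xc i + h + 2 + c - int n"
      using c(2) i by (simp add: of_nat_diff algebra_simps)
    obtain k where "3 * X c = int n * k - h - 2 - c" using X_eq[OF c(1)] by blast
    then have "3 * (xc i - X c) = (3 * xc i + h + 2 + c - int n) - int n * (k - 1)"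
      by (simp add: algebra_simps)
    then show "int n dvd 3 * (xc i - X c)" using dvd_diff[OF 1 dvd_triv_left] by metis
  qed
  note L = line[of "\<lambda>i. wc i (n + 1 - i)" xc X, OF inj_wc_right wc_range xc_range X, folded sq_def]
  show "card {i \<in> {1..n}. sq i (n + 1 - i) > 0} = 4" using L(2) by simp
  show "right_diag_sum n sq = nat (8 * int n + 1)"
    using L(1) X_sum by (simp add: right_diag_sum_def)
qed

section \<open>The set of all line sums\<close>

lemma inj_xc: "inj_on xc {1..n}"
  using inj_on_affine_mod[of 1 n "- 1 - shift"] by (simp add: xc_def[abs_def] algebra_simps)

lemma xc_image: "xc ` {1..n} = {0..<int n}"
  by (rule card_subset_eq) (use xc_range inj_xc in \<open>auto simp: card_image\<close>)

lemma uc_image: "uc ` {1..n} = {0..<int n}"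
  by (rule card_subset_eq)
    (use uc_range inj_on_affine_mod[OF coprime_h1, of "- (h + 1) * (1 + shift)"] in
      \<open>auto simp: card_image uc_def[abs_def] algebra_simps\<close>)

lemma wc_image: "wc i ` {1..n} = {0..<int n}"
  by (rule card_subset_eq) (use wc_range inj_wc_row in \<open>auto simp: card_image\<close>)

lemma line_sums_sq: "line_sums n sq = {7 * n + 1..<7 * n + 1 + (2 * n + 2)}"
proof -
  let ?r = "\<lambda>x. nat (if x = h - 1 then 7 * int n + 1 else 7 * int n + 4 + 2 * x)"
  let ?c = "\<lambda>u. nat (7 * int n + 3 + 2 * u)"
  have "row_sum n sq ` {1..n} = ?r ` {0..<int n}"
    unfolding xc_image[symmetric] image_image row(1) ..
  moreover have "col_sum n sq ` {1..n} = ?c ` {0..<int n}"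
    unfolding uc_image[symmetric] image_image col(1) ..
  ultimately have "line_sums n sq = ?r ` {0..<int n} \<union> ?c ` {0..<int n} \<union> {7 * n + 2, 8 * n + 1}"
    by (simp add: line_sums_def left_diag(1) right_diag(1) nat_add_distrib nat_mult_distrib)
  also have "\<dots> = {7 * n + 1..<7 * n + 1 + (2 * n + 2)}" (is "?U = ?I")
  proof
    show "?U \<subseteq> ?I" using n_eq h_ge by auto
    show "?I \<subseteq> ?U"
    proof
      fix k assume k: "k \<in> ?I"
      consider "k = 7 * n + 1" | "k = 7 * n + 2" | "k = 8 * n + 1"
        | u where "int k = 7 * int n + 3 + 2 * u" "u \<in> {0..<int n}"
        | x where "int k = 7 * int n + 4 + 2 * x" "x \<in> {0..<int n}" "x \<noteq> h - 1"
      proof -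
        \<comment> \<open>Even \<open>v \<ge> 0\<close> belongs to a column and odd \<open>v\<close>
          to a row, with the gap \<open>q = h - 1\<close> filled by the right diagonal. The
          exceptional row and the left diagonal give \<open>v = -2\<close> and
          \<open>v = -1\<close>.\<close>
        define v where "v = int k - 7 * int n - 3"
        define q where "q = v div 2"
        have "v = 2 * q \<or> v = 2 * q + 1" unfolding q_def by presburger
        then consider "v < 0" | "v \<ge> 0" "v = 2 * q" | "v \<ge> 0" "v = 2 * q + 1" "q = h - 1"
          | "v \<ge> 0" "v = 2 * q + 1" "q \<noteq> h - 1" by linarith
        then show ?thesis
        proof cases
          case 1
          then have "k = 7 * n + 1 \<or> k = 7 * n + 2" using k by (auto simp: v_def)
          then show ?thesis using that(1,2) by blast
        next
          case 2
          then show ?thesis using that(4)[of q] k by (auto simp: v_def)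
        next
          case 3
          then have "int k = 8 * int n + 1" using n_eq by (simp add: v_def)
          then show ?thesis using that(3) by linarith
        next
          case 4
          then show ?thesis using that(5)[of q] k by (auto simp: v_def)
        qed
      qed
      then show "k \<in> ?U"
      proof cases
        case 1
        then have "k = ?r (h - 1)" by simp
        then show ?thesis using n_eq h_ge by auto
      next
        case (4 u)
        then have "k = ?c u" by simp
        then show ?thesis using 4 by blast
      next
        case (5 x)
        then have "k = ?r x" by simp
        then show ?thesis using 5 by blast
      qed auto
    qed
  qed
  finally show ?thesis .
qed

section \<open>Each positive value occurs exactly once\<close>

lemma entry_inj:
  assumes "entry x w = entry x' w'" "entry x w > 0"
    and "x \<in> {0..<int n}" "x' \<in> {0..<int n}"
  shows "x = x' \<and> w = w'"
proof -
  have "w \<in> {0, 1, 2, 5}" "w' \<in> {0, 1, 2, 5}"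
    using assms entry_pos_iff by metis+
  then show ?thesis
    using assms(1,3,4) n_eq h_ge by (auto simp: entry_def split: if_splits)
qed

lemma entry_surj:
  assumes "k \<in> {1..n * 4}"
  shows "\<exists>x\<in>{0..<int n}. \<exists>w\<in>{0, 1, 2, 5}. entry x w = k"
proof -
  define v where "v = int k - 1"
  have v: "0 \<le> v" "v < 4 * int n" "k = nat (v + 1)" using assms by (auto simp: v_def)
  consider "v < int n" | "int n \<le> v" "v < 2 * int n" | "2 * int n \<le> v" "v < 3 * int n"
    | "3 * int n \<le> v" by linarith
  then show ?thesis
  proof cases
    case 1
    then have "entry v 0 = k" using v by (simp add: entry_def)
    then show ?thesis using v 1 by force
  next
    case 2
    define x where "x = (if v - int n \<ge> h + 2 then v - int n - h - 2 else v - h - 2)"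
    have "entry x 5 = k" "x \<in> {0..<int n}" using v 2 n_eq h_ge by (auto simp: entry_def x_def)
    then show ?thesis by blast
  next
    case 3
    then have "entry (v - 2 * int n) 2 = k" using v by (simp add: entry_def)
    then show ?thesis using v 3 by force
  next
    case 4
    \<comment> \<open>The reflection of \<open>r\<close> to \<open>h - 1 - r\<close> modulo
      \<open>n\<close> is its own inverse.\<close>
    define x where "x = (if v - 3 * int n \<le> h - 1 then h - 1 - (v - 3 * int n) else h - 1 - v + 4 * int n)"
    have "entry x 1 = k" "x \<in> {0..<int n}" using v 4 n_eq h_ge by (auto simp: entry_def x_def)
    then show ?thesis by blast
  qed
qed

lemma entry_le: "x \<in> {0..<int n} \<Longrightarrow> entry x w \<le> n * 4"
  using n_eq h_ge by (auto simp: entry_def)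

text \<open>Cells correspond bijectively to residue pairs \<open>(xc i, wc i j)\<close>: first
  \<open>i\<close> is recovered from \<open>xc i\<close>, then \<open>j\<close> within row
  \<open>i\<close>.\<close>

lemma sq_unique:
  assumes k: "k \<in> {1..n * 4}"
  shows "\<exists>!p. p \<in> {1..n} \<times> {1..n} \<and> sq (fst p) (snd p) = k"
proof -
  obtain x w where x: "x \<in> {0..<int n}" and w: "w \<in> {0, 1, 2, 5}" and xw: "entry x w = k"
    using entry_surj[OF k] by blast
  have "w \<in> {0..<int n}" using w n_eq h_ge by auto
  obtain i where i: "i \<in> {1..n}" "xc i = x" using x xc_image by (metis imageE)
  obtain j where j: "j \<in> {1..n}" "wc i j = w" using \<open>w \<in> {0..<int n}\<close> wc_image by (metis imageE)
  show ?thesis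
  proof (rule ex1I[of _ "(i, j)"])
    show "(i, j) \<in> {1..n} \<times> {1..n} \<and> sq (fst (i, j)) (snd (i, j)) = k"
      using i j xw by (simp add: sq_def)
    fix p assume p: "p \<in> {1..n} \<times> {1..n} \<and> sq (fst p) (snd p) = k"
    obtain i' j' where [simp]: "p = (i', j')" by (cases p)
    have eq: "xc i = xc i' \<and> wc i j = wc i' j'"
      by (rule entry_inj[OF _ _ xc_range xc_range]) (use p k i j xw in \<open>auto simp: sq_def\<close>)
    then have "i' = i" using inj_onD[OF inj_xc, of i i'] p i by auto
    moreover from this have "j' = j"
      using inj_onD[OF inj_wc_row, of i j j'] p j eq by auto
    ultimately show "p = (i, j)" by simp
  qed
qed

lemma regular_SAMS_sq: "regular_SAMS n 4 sq"
proof -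
  have "sq i j \<in> {0..n * 4}" for i j
    using entry_le[OF xc_range] by (simp add: sq_def)
  moreover have "4 < n" using n_eq h_ge by linarith
  ultimately have "SAMS n 4 sq"
    unfolding SAMS_def using sq_unique line_sums_sq by (intro conjI exI[of _ "7 * n + 1"]) auto
  then show ?thesis
    unfolding regular_SAMS_def using row(2) col(2) left_diag(2) right_diag(2) by blast
qed

end

theorem theorem5p1:
  fixes n :: nat
  assumes "n \<ge> 7" and "n mod 6 = 1 \<or> n mod 6 = 5"
  shows "\<exists>A. regular_SAMS n 4 A"
proof -
  interpret order_coprime_to_6 n "int n div 2"
    by unfold_locales (use assms in presburger)+
  show ?thesis using regular_SAMS_sq by blast
qed

end
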